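(* Let $\mathcal A$ and $\mathfrak A$ be Banach algebras such that $\mathcal A$ is a Banach $\mathfrak A$-bimodule with compatible actions. If $\mathcal A\rtimes\mathfrak A$ is cyclicly amenable, then the following assertions hold. (i) $\mathfrak A$ is cyclicly amenable. (ii) If the pair $(\mathcal A,\mathfrak A)$ has the property $(\mathbb H_1)$, then $\mathcal A$ is cyclicly amenable.
   Context: The actions of $\mathfrak A$ on $\mathcal A$ are compatible if for all $a,b\in\mathcal A$ and $\beta\in\mathfrak A$: $\beta\cdot(ab)=(\beta\cdot a)b$, $(ab)\cdot\beta=a(b\cdot\beta)$, $a(\beta\cdot b)=(a\cdot\beta)b$. The amalgamated duplication $\mathcal A\rtimes\mathfrak A$ is $\mathcal A\times\mathfrak A$ with product $(a,\beta)(b,\gamma)=(ab+a\cdot\gamma+\beta\cdot b,\ \beta\gamma)$ and norm $\|(a,\beta)\|=\|a\|+\|\beta\|$. $\mathcal Y^{(1)}$ is the dual of $\mathcal Y$. Notation, for $a,b\in\mathcal A$, $\beta,\gamma\in\mathfrak A$, $x\in\mathcal A^{(1)}$, $y\in\mathfrak A^{(1)}$: $a\vartriangle x,\ x\circ a\in\mathcal A^{(1)}$ with $\langle a\vartriangle x,b\rangle=\langle x,ba\rangle$, $\langle x\circ a,b\rangle=\langle x,ab\rangle$; $\beta\vartriangle y,\ y\circ\beta\in\mathfrak A^{(1)}$ with $\langle\beta\vartriangle y,\gamma\rangle=\langle y,\gamma\beta\rangle$, $\langle y\circ\beta,\gamma\rangle=\langle y,\beta\gamma\rangle$; $\beta\blacktriangle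 x,\ x\bullet\beta\in\mathcal A^{(1)}$ with $\langle\beta\blacktriangle x,b\rangle=\langle x,b\cdot\beta\rangle$, $\langle x\bullet\beta,b\rangle=\langle x,\beta\cdot b\rangle$; $a\blacktriangle x,\ x\bullet a\in\mathfrak A^{(1)}$ with $\langle a\blacktriangle x,\gamma\rangle=\langle x,\gamma\cdot a\rangle$, $\langle x\bullet a,\gamma\rangle=\langle x,a\cdot\gamma\rangle$. A derivation from a Banach algebra $\mathcal C$ into a Banach $\mathcal C$-bimodule $\mathcal X$ is a continuous linear map $D$ with $D(c_1c_2)=D(c_1)\cdot c_2+c_1\cdot D(c_2)$; it is inner if $D(c)=c\cdot x-x\cdot c$ for some $x\in\mathcal X$. Duals carry the usual dual bimodule structure ($\langle f\cdot c,x\rangle=\langle f,c\cdot x\rangle$, $\langle c\cdot f,x\rangle=\langle f,x\cdot c\rangle$). A derivation $D:\mathcal C\to\mathcal C^{(1)}$ is cyclic if $\langle D(c_1),c_2\rangle+\langle D(c_2),c_1\rangle=0$ for all $c_1,c_2\in\mathcal C$; $\mathcal C$ is cyclicly amenable if every cyclic derivation $\mathcal C\to\mathcal C^{(1)}$ is inner. The pair $(\mathcal A,\mathfrak A)$ has the property $(\mathbb H_1)$ if for each derivation $D^1_{\mathcal A}:\mathcal A\to\mathcal A^{(1)}$ there are a derivation $D^1_{\mathfrak A}:\mathfrak A\to\mathcal A^{(1)}$ and a bounded linear map $D^2_{\mathcal A}:\mathcal A\to\mathfrak A^{(1)}$ such that for all $a,b\in\mathcal A$, $\beta\in\mathfrak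 A$: $D^1_{\mathcal A}(\beta\cdot a)=D^1_{\mathfrak A}(\beta)\circ a+\beta\blacktriangle D^1_{\mathcal A}(a)$; $D^1_{\mathcal A}(a\cdot\beta)=a\vartriangle D^1_{\mathfrak A}(\beta)+D^1_{\mathcal A}(a)\bullet\beta$; $D^2_{\mathcal A}(\beta\cdot a)=D^1_{\mathfrak A}(\beta)\bullet a+\beta\vartriangle D^2_{\mathcal A}(a)$; $D^2_{\mathcal A}(a\cdot\beta)=a\blacktriangle D^1_{\mathfrak A}(\beta)+D^2_{\mathcal A}(a)\circ\beta$; $D^2_{\mathcal A}(ab)=D^1_{\mathcal A}(a)\bullet b+a\blacktriangle D^1_{\mathcal A}(b)$. *)

theory Defs
  imports "HOL-Analysis.Analysis"
begin

section \<open>Complex Banach spaces and Banach algebras\<close>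

class complex_normed_vector = real_normed_vector +
  fixes scaleC :: "complex \<Rightarrow> 'a \<Rightarrow> 'a"  (infixr \<open>*\<^sub>C\<close> 75)
  assumes scaleC_add_right: "c *\<^sub>C (x + y) = c *\<^sub>C x + c *\<^sub>C y"
    and scaleC_add_left: "(c + d) *\<^sub>C x = c *\<^sub>C x + d *\<^sub>C x"
    and scaleC_scaleC: "c *\<^sub>C d *\<^sub>C x = (c * d) *\<^sub>C x"
    and scaleR_scaleC: "r *\<^sub>R x = complex_of_real r *\<^sub>C x"
    and norm_scaleC: "norm (c *\<^sub>C x) = norm c * norm x"

class complex_banach = complex_normed_vector + banach

text \<open>No unit is required: \<^class>\<open>real_normed_algebra\<close> asks for an associative, bilinear,
  submultiplicative product.\<close>

class complex_banach_algebra = complex_banach + real_normed_algebra +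
  assumes mult_scaleC_left: "c *\<^sub>C x * y = c *\<^sub>C (x * y)"
    and mult_scaleC_right: "x * c *\<^sub>C y = c *\<^sub>C (x * y)"

definition bounded_clinear ::
  "('a::complex_normed_vector \<Rightarrow> 'b::complex_normed_vector) \<Rightarrow> bool" where
  "bounded_clinear T \<longleftrightarrow> bounded_linear T \<and> (\<forall>c x. T (c *\<^sub>C x) = c *\<^sub>C T x)"

definition bounded_cbilinear ::
  "('a::complex_normed_vector \<Rightarrow> 'b::complex_normed_vector \<Rightarrow> 'c::complex_normed_vector) \<Rightarrow> bool"
  where
  "bounded_cbilinear B \<longleftrightarrow> bounded_bilinear B \<and>
     (\<forall>c x y. B (c *\<^sub>C x) y = c *\<^sub>C B x y \<and> B x (c *\<^sub>C y) = c *\<^sub>C B x y)"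

lemma bounded_cbilinear_left: "bounded_cbilinear B \<Longrightarrow> bounded_clinear (\<lambda>x. B x y)"
  and bounded_cbilinear_right: "bounded_cbilinear B \<Longrightarrow> bounded_clinear (B x)"
  by (auto simp: bounded_cbilinear_def bounded_clinear_def
      bounded_bilinear.bounded_linear_left bounded_bilinear.bounded_linear_right)

lemma bounded_cbilinear_times:
  "bounded_cbilinear ((*) :: 'a::complex_banach_algebra \<Rightarrow> 'a \<Rightarrow> 'a)"
  by (simp add: bounded_cbilinear_def bounded_bilinear_mult mult_scaleC_left mult_scaleC_right)


section \<open>The dual space\<close>

typedef (overloaded) 'a dual =
  "{f :: 'a::complex_normed_vector \<Rightarrow>\<^sub>L complex. \<forall>c x. blinfun_apply f (c *\<^sub>C x) = c * blinfun_apply f x}"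
  by (intro exI[of _ 0]) simp

setup_lifting type_definition_dual

lift_definition dual_apply :: "'a::complex_normed_vector dual \<Rightarrow> 'a \<Rightarrow> complex" is blinfun_apply .

lemma dual_eqI: "(\<And>x. dual_apply f x = dual_apply g x) \<Longrightarrow> f = g"
  by transfer (auto intro: blinfun_eqI)

lemma norm_blinfun_mult_right_compose:
  "norm (blinfun_mult_right c o\<^sub>L f) = norm c * norm f" for f :: "'a::real_normed_vector \<Rightarrow>\<^sub>L complex"
proof -
  have le: "norm (blinfun_mult_right c o\<^sub>L f) \<le> norm c * norm f"
    for c and f :: "'a \<Rightarrow>\<^sub>L complex"
    by (rule norm_blinfun_bound) (auto simp: norm_mult mult.assoc intro!: mult_left_mono norm_blinfun)
  show ?thesis
  proof (cases "c = 0")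
    case True
    then show ?thesis using le[of c f] by simp
  next
    case False
    have "f = blinfun_mult_right (inverse c) o\<^sub>L (blinfun_mult_right c o\<^sub>L f)"
      using False by (intro blinfun_eqI) simp
    then have "norm f \<le> norm (inverse c) * norm (blinfun_mult_right c o\<^sub>L f)"
      using le[of "inverse c" "blinfun_mult_right c o\<^sub>L f"] by simp
    then have "norm c * norm f \<le> norm (blinfun_mult_right c o\<^sub>L f)"
      using False by (simp add: norm_divide field_simps)
    then show ?thesis using le[of c f] by simp
  qed
qed

instantiation dual :: (complex_normed_vector) complex_normed_vector
begin

lift_definition zero_dual :: "'a dual" is 0 by simp
lift_definition plus_dual :: "'a dual \<Rightarrow> 'a dual \<Rightarrow> 'a dual" is "(+)"
  by (simp add: blinfun.add_left distrib_left)
lift_definition minus_dual :: "'a dual \<Rightarrow> 'a dual \<Rightarrow> 'a dual" is "(-)"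
  by (simp add: blinfun.diff_left right_diff_distrib)
lift_definition uminus_dual :: "'a dual \<Rightarrow> 'a dual" is uminus
  by (simp add: blinfun.minus_left)
lift_definition scaleR_dual :: "real \<Rightarrow> 'a dual \<Rightarrow> 'a dual" is scaleR
  by (simp add: blinfun.scaleR_left)
lift_definition scaleC_dual :: "complex \<Rightarrow> 'a dual \<Rightarrow> 'a dual" is "\<lambda>c f. blinfun_mult_right c o\<^sub>L f"
  by simp
lift_definition norm_dual :: "'a dual \<Rightarrow> real" is norm .
definition dist_dual :: "'a dual \<Rightarrow> 'a dual \<Rightarrow> real" where "dist_dual f g = norm (f - g)"
definition sgn_dual :: "'a dual \<Rightarrow> 'a dual" where "sgn_dual f = scaleR (inverse (norm f)) f"
definition uniformity_dual :: "('a dual \<times> 'a dual) filter" where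
  "uniformity_dual = (INF e\<in>{0 <..}. principal {(f, g). dist f g < e})"
definition open_dual :: "'a dual set \<Rightarrow> bool" where
  "open_dual U = (\<forall>f\<in>U. \<forall>\<^sub>F (f', g) in uniformity. f' = f \<longrightarrow> g \<in> U)"

instance
proof
  fix f g h :: "'a dual" and r s :: real and c d :: complex
  show "f + g + h = f + (g + h)" by transfer simp
  show "f + g = g + f" by transfer simp
  show "0 + f = f" by transfer simp
  show "- f + f = 0" by transfer simp
  show "f - g = f + - g" by transfer simp
  show "r *\<^sub>R (f + g) = r *\<^sub>R f + r *\<^sub>R g" by transfer (simp add: scaleR_add_right)
  show "(r + s) *\<^sub>R f = r *\<^sub>R f + s *\<^sub>R f" by transfer (simp add: scaleR_add_left)
  show "r *\<^sub>R s *\<^sub>R f = (r * s) *\<^sub>R f" by transfer simp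
  show "1 *\<^sub>R f = f" by transfer simp
  show "sgn f = inverse (norm f) *\<^sub>R f" by (rule sgn_dual_def)
  show "dist f g = norm (f - g)" by (rule dist_dual_def)
  show "(uniformity :: ('a dual \<times> 'a dual) filter) = (INF e\<in>{0 <..}. principal {(f, g). dist f g < e})"
    by (rule uniformity_dual_def)
  show "open U = (\<forall>f\<in>U. \<forall>\<^sub>F (f', g) in uniformity. f' = f \<longrightarrow> g \<in> U)" for U :: "'a dual set"
    by (rule open_dual_def)
  show "norm f = 0 \<longleftrightarrow> f = 0" by transfer simp
  show "norm (f + g) \<le> norm f + norm g" by transfer (rule norm_triangle_ineq)
  show "norm (r *\<^sub>R f) = \<bar>r\<bar> * norm f" by transfer simp
  show "c *\<^sub>C (f + g) = c *\<^sub>C f + c *\<^sub>C g"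
    by transfer (auto intro!: blinfun_eqI simp: blinfun.add_left distrib_left)
  show "(c + d) *\<^sub>C f = c *\<^sub>C f + d *\<^sub>C f"
    by transfer (auto intro!: blinfun_eqI simp: blinfun.add_left distrib_right)
  show "c *\<^sub>C d *\<^sub>C f = (c * d) *\<^sub>C f"
    by transfer (auto intro!: blinfun_eqI)
  show "r *\<^sub>R f = complex_of_real r *\<^sub>C f"
    by transfer (auto intro!: blinfun_eqI simp: blinfun.scaleR_left scaleR_conv_of_real)
  show "norm (c *\<^sub>C f) = norm c * norm f"
    by transfer (rule norm_blinfun_mult_right_compose)
qed

end

lemma dual_apply_add: "dual_apply (f + g) x = dual_apply f x + dual_apply g x"
  by transfer (simp add: blinfun.add_left)

lemma dual_apply_diff: "dual_apply (f - g) x = dual_apply f x - dual_apply g x"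
  by transfer (simp add: blinfun.diff_left)

lemma dual_apply_scaleR: "dual_apply (r *\<^sub>R f) x = r *\<^sub>R dual_apply f x"
  by transfer (simp add: blinfun.scaleR_left)

lemma dual_apply_scaleC: "dual_apply (c *\<^sub>C f) x = c * dual_apply f x"
  by transfer simp

lemma dual_apply_zero: "dual_apply 0 x = 0"
  by transfer simp

lemma dual_apply_add_right: "dual_apply f (x + y) = dual_apply f x + dual_apply f y"
  by transfer (simp add: blinfun.add_right)

lemma dual_apply_scaleC_right: "dual_apply f (c *\<^sub>C x) = c * dual_apply f x"
  by transfer simp

lemma bounded_linear_dual_apply: "bounded_linear (dual_apply f)"
  by transfer (rule blinfun.bounded_linear_right)

lemma norm_dual_apply: "norm (dual_apply f x) \<le> norm f * norm x"
  by transfer (rule norm_blinfun)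

lemma norm_dual_bound:
  "0 \<le> K \<Longrightarrow> (\<And>x. norm (dual_apply f x) \<le> K * norm x) \<Longrightarrow> norm f \<le> K"
  by transfer (rule norm_blinfun_bound)

instance dual :: (complex_normed_vector) complex_banach
proof
  fix X :: "nat \<Rightarrow> 'a dual"
  assume X: "Cauchy X"
  have dist: "dist (Rep_dual f) (Rep_dual g) = dist f g" for f g :: "'a dual"
    by (simp add: dist_norm norm_dual.rep_eq minus_dual.rep_eq)
  from X have "Cauchy (\<lambda>n. Rep_dual (X n))"
    by (simp add: Cauchy_def dist)
  then obtain L where L: "(\<lambda>n. Rep_dual (X n)) \<longlonglongrightarrow> L"
    using Cauchy_convergent convergent_def by blast
  have lim: "(\<lambda>n. blinfun_apply (Rep_dual (X n)) x) \<longlonglongrightarrow> blinfun_apply L x" for x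
    using L by (rule blinfun.tendsto) simp
  have "blinfun_apply L (c *\<^sub>C x) = c * blinfun_apply L x" for c x
  proof (rule LIMSEQ_unique[OF lim])
    have "blinfun_apply (Rep_dual (X n)) (c *\<^sub>C x) = c * blinfun_apply (Rep_dual (X n)) x" for n
      using Rep_dual[of "X n"] by simp
    then show "(\<lambda>n. blinfun_apply (Rep_dual (X n)) (c *\<^sub>C x)) \<longlonglongrightarrow> c * blinfun_apply L x"
      using tendsto_mult_left[OF lim, of c x] by simp
  qed
  then have "Rep_dual (Abs_dual L) = L"
    by (simp add: Abs_dual_inverse)
  then have "X \<longlonglongrightarrow> Abs_dual L"
    using L by (simp add: LIMSEQ_def flip: dist)
  then show "convergent X"
    by (rule convergentI)
qed

text \<open>\<open>pullback T f\<close> is the functional \<open>f \<circ> T\<close>. It is meaningful for bounded linear \<open>T\<close>;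
  every \<open>T\<close> used below is a partial application of a bounded bilinear map.\<close>

definition pullback ::
  "('a::complex_normed_vector \<Rightarrow> 'b::complex_normed_vector) \<Rightarrow> 'b dual \<Rightarrow> 'a dual" where
  "pullback T f = Abs_dual (Blinfun (\<lambda>x. dual_apply f (T x)))"

lemma dual_apply_pullback:
  assumes "bounded_clinear T"
  shows "dual_apply (pullback T f) x = dual_apply f (T x)"
proof -
  have T: "bounded_linear T" "\<And>c x. T (c *\<^sub>C x) = c *\<^sub>C T x"
    using assms by (auto simp: bounded_clinear_def)
  have "bounded_linear (\<lambda>x. dual_apply f (T x))"
    using bounded_linear_compose[OF bounded_linear_dual_apply T(1)] .
  then have ap: "blinfun_apply (Blinfun (\<lambda>x. dual_apply f (T x))) = (\<lambda>x. dual_apply f (T x))"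
    by (rule bounded_linear_Blinfun_apply)
  then have "Rep_dual (pullback T f) = Blinfun (\<lambda>x. dual_apply f (T x))"
    unfolding pullback_def by (intro Abs_dual_inverse) (simp add: T dual_apply_scaleC_right)
  then show ?thesis
    using fun_cong[OF ap, of x] by (simp only: dual_apply.rep_eq)
qed


section \<open>Banach bimodules and derivations\<close>

text \<open>The product \<open>m\<close> is an explicit parameter because the product of the amalgamated duplication
  depends on the module actions, so it cannot be the type-class product.\<close>

locale banach_bimodule =
  fixes m :: "'c::complex_banach \<Rightarrow> 'c \<Rightarrow> 'c"
    and lact :: "'c \<Rightarrow> 'x::complex_banach \<Rightarrow> 'x"
    and ract :: "'x \<Rightarrow> 'c \<Rightarrow> 'x"
  assumes bounded_lact: "bounded_cbilinear lact"
    and bounded_ract: "bounded_cbilinear ract"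
    and lact_mult: "lact (m c d) x = lact c (lact d x)"
    and ract_mult: "ract x (m c d) = ract (ract x c) d"
    and lact_ract: "ract (lact c x) d = lact c (ract x d)"

definition dual_lact :: "('x::complex_banach \<Rightarrow> 'c \<Rightarrow> 'x) \<Rightarrow> 'c \<Rightarrow> 'x dual \<Rightarrow> 'x dual" where
  "dual_lact ract c f = pullback (\<lambda>x. ract x c) f"

definition dual_ract :: "('c \<Rightarrow> 'x::complex_banach \<Rightarrow> 'x) \<Rightarrow> 'x dual \<Rightarrow> 'c \<Rightarrow> 'x dual" where
  "dual_ract lact f c = pullback (\<lambda>x. lact c x) f"

lemma dual_apply_dual_lact:
  "bounded_cbilinear ract \<Longrightarrow> dual_apply (dual_lact ract c f) x = dual_apply f (ract x c)"
  by (simp add: dual_lact_def dual_apply_pullback bounded_cbilinear_left)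

lemma dual_apply_dual_ract:
  "bounded_cbilinear lact \<Longrightarrow> dual_apply (dual_ract lact f c) x = dual_apply f (lact c x)"
  by (simp add: dual_ract_def dual_apply_pullback bounded_cbilinear_right)

lemma bounded_cbilinear_dual_lact:
  assumes "bounded_cbilinear ract"
  shows "bounded_cbilinear (dual_lact ract)"
proof -
  have b: "bounded_bilinear ract" and c: "\<And>a x y. ract x (a *\<^sub>C y) = a *\<^sub>C ract x y"
    using assms by (auto simp: bounded_cbilinear_def)
  interpret bounded_bilinear ract by (rule b)
  note ap = dual_apply_dual_lact[OF assms]
  have "bounded_bilinear (dual_lact ract)"
  proof
    obtain K where K: "0 \<le> K" "\<And>x y. norm (ract x y) \<le> norm x * norm y * K"
      using nonneg_bounded by blast
    have "norm (dual_lact ract c f) \<le> norm c * norm f * K" for c f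
    proof (rule norm_dual_bound)
      fix x
      have "norm (dual_apply f (ract x c)) \<le> norm f * (norm x * norm c * K)"
        using norm_dual_apply[of f "ract x c"] K(2)[of x c]
        by (meson mult_left_mono norm_ge_zero order_trans)
      then show "norm (dual_apply (dual_lact ract c f) x) \<le> norm c * norm f * K * norm x"
        by (simp add: ap mult_ac)
    qed (use K in simp)
    then show "\<exists>K. \<forall>c f. norm (dual_lact ract c f) \<le> norm c * norm f * K" by blast
  qed (auto intro!: dual_eqI simp: ap add_right scaleR_right dual_apply_add dual_apply_add_right
      dual_apply_scaleR
      linear_scale[OF bounded_linear.linear[OF bounded_linear_dual_apply]])
  then show ?thesis
    by (auto simp: bounded_cbilinear_def ap c dual_apply_scaleC dual_apply_scaleC_right
        intro!: dual_eqI)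
qed

lemma bounded_cbilinear_flip: "bounded_cbilinear B \<Longrightarrow> bounded_cbilinear (\<lambda>x y. B y x)"
  by (auto simp: bounded_cbilinear_def bounded_bilinear.flip)

lemma bounded_cbilinear_dual_ract:
  assumes "bounded_cbilinear lact"
  shows "bounded_cbilinear (dual_ract lact)"
  using bounded_cbilinear_flip[OF bounded_cbilinear_dual_lact[OF bounded_cbilinear_flip[OF assms]]]
  by (simp add: dual_lact_def dual_ract_def[abs_def])

lemma banach_bimodule_dual:
  assumes "banach_bimodule m lact ract"
  shows "banach_bimodule m (dual_lact ract) (dual_ract lact)"
proof -
  interpret banach_bimodule m lact ract by fact
  show ?thesis
    by unfold_locales
      (auto intro!: dual_eqI bounded_cbilinear_dual_lact bounded_cbilinear_dual_ract
        simp: dual_apply_dual_lact dual_apply_dual_ract bounded_lact bounded_ract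
        lact_mult ract_mult lact_ract)
qed

definition derivation ::
  "('c::complex_banach \<Rightarrow> 'c \<Rightarrow> 'c) \<Rightarrow> ('c \<Rightarrow> 'x::complex_banach \<Rightarrow> 'x) \<Rightarrow> ('x \<Rightarrow> 'c \<Rightarrow> 'x)
    \<Rightarrow> ('c \<Rightarrow> 'x) \<Rightarrow> bool" where
  "derivation m lact ract D \<longleftrightarrow> bounded_clinear D \<and>
     (\<forall>c d. D (m c d) = ract (D c) d + lact c (D d))"

definition inner_derivation ::
  "('c \<Rightarrow> 'x::complex_banach \<Rightarrow> 'x) \<Rightarrow> ('x \<Rightarrow> 'c \<Rightarrow> 'x) \<Rightarrow> ('c \<Rightarrow> 'x) \<Rightarrow> bool" where
  "inner_derivation lact ract D \<longleftrightarrow> (\<exists>x. \<forall>c. D c = lact c x - ract x c)"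

definition cyclic :: "('c::complex_banach \<Rightarrow> 'c dual) \<Rightarrow> bool" where
  "cyclic D \<longleftrightarrow> (\<forall>c d. dual_apply (D c) d + dual_apply (D d) c = 0)"

definition cyclicly_amenable :: "('c::complex_banach \<Rightarrow> 'c \<Rightarrow> 'c) \<Rightarrow> bool" where
  "cyclicly_amenable m \<longleftrightarrow>
     (\<forall>D. derivation m (dual_lact m) (dual_ract m) D \<and> cyclic D
        \<longrightarrow> inner_derivation (dual_lact m) (dual_ract m) D)"


section \<open>The amalgamated duplication\<close>

definition compatible_actions ::
  "('f \<Rightarrow> 'a::complex_banach_algebra \<Rightarrow> 'a) \<Rightarrow> ('a \<Rightarrow> 'f::complex_banach_algebra \<Rightarrow> 'a) \<Rightarrow> bool" where
  "compatible_actions lact ract \<longleftrightarrow>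
     (\<forall>a b \<beta>. lact \<beta> (a * b) = lact \<beta> a * b \<and>
              ract (a * b) \<beta> = a * ract b \<beta> \<and>
              a * lact \<beta> b = ract a \<beta> * b)"

text \<open>A copy of the product type, because \<^typ>\<open>'a \<times> 'b\<close> already carries the Euclidean norm
  \<open>sqrt ((norm a)\<^sup>2 + (norm b)\<^sup>2)\<close> instead of \<open>norm a + norm b\<close>.\<close>

datatype ('a, 'b) amalg = Amalg (fst_amalg: 'a) (snd_amalg: 'b)

lemma amalg_eq_iff: "p = q \<longleftrightarrow> fst_amalg p = fst_amalg q \<and> snd_amalg p = snd_amalg q"
  by (cases p; cases q) simp

instantiation amalg :: (complex_normed_vector, complex_normed_vector) complex_normed_vector
begin

definition "0 = Amalg 0 0"
definition "p + q = Amalg (fst_amalg p + fst_amalg q) (snd_amalg p + snd_amalg q)"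
definition "p - q = Amalg (fst_amalg p - fst_amalg q) (snd_amalg p - snd_amalg q)"
definition "- p = Amalg (- fst_amalg p) (- snd_amalg p)"
definition "r *\<^sub>R p = Amalg (r *\<^sub>R fst_amalg p) (r *\<^sub>R snd_amalg p)"
definition "c *\<^sub>C p = Amalg (c *\<^sub>C fst_amalg p) (c *\<^sub>C snd_amalg p)"
definition "norm p = norm (fst_amalg p) + norm (snd_amalg p)"
definition dist_amalg :: "('a, 'b) amalg \<Rightarrow> ('a, 'b) amalg \<Rightarrow> real" where
  "dist_amalg p q = norm (p - q)"
definition sgn_amalg :: "('a, 'b) amalg \<Rightarrow> ('a, 'b) amalg" where
  "sgn_amalg p = scaleR (inverse (norm p)) p"
definition uniformity_amalg :: "(('a, 'b) amalg \<times> ('a, 'b) amalg) filter" where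
  "uniformity_amalg = (INF e\<in>{0 <..}. principal {(p, q). dist p q < e})"
definition open_amalg :: "('a, 'b) amalg set \<Rightarrow> bool" where
  "open_amalg U = (\<forall>p\<in>U. \<forall>\<^sub>F (p', q) in uniformity. p' = p \<longrightarrow> q \<in> U)"

instance
proof
  fix p q s :: "('a, 'b) amalg" and r t :: real and c d :: complex
  show "p + q + s = p + (q + s)" by (simp add: plus_amalg_def add.assoc)
  show "p + q = q + p" by (simp add: plus_amalg_def add.commute)
  show "0 + p = p" by (simp add: plus_amalg_def zero_amalg_def)
  show "- p + p = 0" by (simp add: plus_amalg_def uminus_amalg_def zero_amalg_def)
  show "p - q = p + - q" by (simp add: plus_amalg_def uminus_amalg_def minus_amalg_def)
  show "r *\<^sub>R (p + q) = r *\<^sub>R p + r *\<^sub>R q"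
    by (simp add: plus_amalg_def scaleR_amalg_def scaleR_add_right)
  show "(r + t) *\<^sub>R p = r *\<^sub>R p + t *\<^sub>R p"
    by (simp add: plus_amalg_def scaleR_amalg_def scaleR_add_left)
  show "r *\<^sub>R t *\<^sub>R p = (r * t) *\<^sub>R p" by (simp add: scaleR_amalg_def)
  show "1 *\<^sub>R p = p" by (simp add: scaleR_amalg_def)
  show "sgn p = inverse (norm p) *\<^sub>R p" by (rule sgn_amalg_def)
  show "dist p q = norm (p - q)" by (rule dist_amalg_def)
  show "(uniformity :: (('a, 'b) amalg \<times> ('a, 'b) amalg) filter)
      = (INF e\<in>{0 <..}. principal {(p, q). dist p q < e})"
    by (rule uniformity_amalg_def)
  show "open U = (\<forall>p\<in>U. \<forall>\<^sub>F (p', q) in uniformity. p' = p \<longrightarrow> q \<in> U)" for U :: "('a, 'b) amalg set"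
    by (rule open_amalg_def)
  show "norm p = 0 \<longleftrightarrow> p = 0"
    by (simp add: norm_amalg_def zero_amalg_def amalg_eq_iff add_nonneg_eq_0_iff)
  show "norm (p + q) \<le> norm p + norm q"
    using norm_triangle_ineq[of "fst_amalg p" "fst_amalg q"]
      norm_triangle_ineq[of "snd_amalg p" "snd_amalg q"]
    by (simp add: norm_amalg_def plus_amalg_def)
  show "norm (r *\<^sub>R p) = \<bar>r\<bar> * norm p"
    by (simp add: norm_amalg_def scaleR_amalg_def distrib_left)
  show "c *\<^sub>C (p + q) = c *\<^sub>C p + c *\<^sub>C q"
    by (simp add: plus_amalg_def scaleC_amalg_def scaleC_add_right)
  show "(c + d) *\<^sub>C p = c *\<^sub>C p + d *\<^sub>C p"
    by (simp add: plus_amalg_def scaleC_amalg_def scaleC_add_left)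
  show "c *\<^sub>C d *\<^sub>C p = (c * d) *\<^sub>C p"
    by (simp add: scaleC_amalg_def scaleC_scaleC)
  show "r *\<^sub>R p = complex_of_real r *\<^sub>C p"
    by (simp add: scaleC_amalg_def scaleR_amalg_def scaleR_scaleC)
  show "norm (c *\<^sub>C p) = norm c * norm p"
    by (simp add: norm_amalg_def scaleC_amalg_def norm_scaleC distrib_left)
qed

end

instance amalg :: (complex_banach, complex_banach) complex_banach
proof
  fix X :: "nat \<Rightarrow> ('a, 'b) amalg"
  assume X: "Cauchy X"
  have dist: "dist p q = dist (fst_amalg p) (fst_amalg q) + dist (snd_amalg p) (snd_amalg q)"
    for p q :: "('a, 'b) amalg"
    by (simp add: dist_norm norm_amalg_def minus_amalg_def)
  have "Cauchy (\<lambda>n. fst_amalg (X n))" "Cauchy (\<lambda>n. snd_amalg (X n))"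
    using X unfolding Cauchy_def dist by (meson add_lessD1 zero_le_dist le_less_trans
        le_add_same_cancel1 le_add_same_cancel2)+
  then obtain a b where ab: "(\<lambda>n. fst_amalg (X n)) \<longlonglongrightarrow> a" "(\<lambda>n. snd_amalg (X n)) \<longlonglongrightarrow> b"
    using Cauchy_convergent convergent_def by metis
  have "(\<lambda>n. dist (fst_amalg (X n)) a + dist (snd_amalg (X n)) b) \<longlonglongrightarrow> 0"
    using tendsto_add[OF ab[THEN tendsto_dist_iff[THEN iffD1]]] by simp
  then have "X \<longlonglongrightarrow> Amalg a b"
    by (simp add: tendsto_dist_iff[of X] dist)
  then show "convergent X"
    by (rule convergentI)
qed

fun amalg_mult ::
  "('f \<Rightarrow> 'a \<Rightarrow> 'a) \<Rightarrow> ('a \<Rightarrow> 'f \<Rightarrow> 'a)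
    \<Rightarrow> ('a::complex_banach_algebra, 'f::complex_banach_algebra) amalg
    \<Rightarrow> ('a, 'f) amalg \<Rightarrow> ('a, 'f) amalg" where
  "amalg_mult lact ract (Amalg a \<beta>) (Amalg b \<gamma>) = Amalg (a * b + ract a \<gamma> + lact \<beta> b) (\<beta> * \<gamma>)"

text \<open>Associativity uses all three compatibility identities. The bimodule axioms only bound the actions
  up to a constant, so the product is jointly continuous; it is submultiplicative when the actions
  are contractive.\<close>

lemma amalg_mult_assoc:
  assumes "banach_bimodule (*) lact ract" "compatible_actions lact ract"
  shows "amalg_mult lact ract (amalg_mult lact ract p q) r = amalg_mult lact ract p (amalg_mult lact ract q r)"
proof -
  interpret banach_bimodule "(*)" lact ract by fact
  interpret l: bounded_bilinear lact using bounded_lact by (simp add: bounded_cbilinear_def)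
  interpret r: bounded_bilinear ract using bounded_ract by (simp add: bounded_cbilinear_def)
  show ?thesis
    using assms(2)
    by (cases p; cases q; cases r)
      (simp add: compatible_actions_def algebra_simps l.add_right r.add_left lact_mult ract_mult lact_ract)
qed

lemma bounded_cbilinear_amalg_mult:
  assumes "banach_bimodule (*) lact ract"
  shows "bounded_cbilinear (amalg_mult lact ract)"
proof -
  interpret banach_bimodule "(*)" lact ract by fact
  interpret l: bounded_bilinear lact using bounded_lact by (simp add: bounded_cbilinear_def)
  interpret r: bounded_bilinear ract using bounded_ract by (simp add: bounded_cbilinear_def)
  have l_scaleC: "lact (c *\<^sub>C \<beta>) a = c *\<^sub>C lact \<beta> a" "lact \<beta> (c *\<^sub>C a) = c *\<^sub>C lact \<beta> a" for c \<beta> a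
    using bounded_lact by (auto simp: bounded_cbilinear_def)
  have r_scaleC: "ract (c *\<^sub>C a) \<beta> = c *\<^sub>C ract a \<beta>" "ract a (c *\<^sub>C \<beta>) = c *\<^sub>C ract a \<beta>" for c \<beta> a
    using bounded_ract by (auto simp: bounded_cbilinear_def)
  have "bounded_bilinear (amalg_mult lact ract)"
  proof
    obtain K where K: "0 \<le> K" "\<And>\<beta> a. norm (lact \<beta> a) \<le> norm \<beta> * norm a * K"
      using l.nonneg_bounded by blast
    obtain L where L: "0 \<le> L" "\<And>a \<beta>. norm (ract a \<beta>) \<le> norm a * norm \<beta> * L"
      using r.nonneg_bounded by blast
    have "norm (amalg_mult lact ract (Amalg a \<beta>) (Amalg b \<gamma>))
      \<le> norm (Amalg a \<beta>) * norm (Amalg b \<gamma>) * (1 + K + L)" for a b \<beta> \<gamma>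
    proof -
      have "norm (a * b + ract a \<gamma> + lact \<beta> b) + norm (\<beta> * \<gamma>)
          \<le> norm a * norm b + norm a * norm \<gamma> * L + norm \<beta> * norm b * K + norm \<beta> * norm \<gamma>"
        by (intro add_mono norm_triangle_le norm_mult_ineq K L)
      also have "\<dots> \<le> (norm a + norm \<beta>) * (norm b + norm \<gamma>) * (1 + K + L)"
        using K(1) L(1) by (simp add: algebra_simps)
      finally show ?thesis by (simp add: norm_amalg_def)
    qed
    then show "\<exists>K. \<forall>p q. norm (amalg_mult lact ract p q) \<le> norm p * norm q * K"
      by (metis amalg.exhaust)
  next
    fix p p' q q' :: "('b, 'a) amalg" and r :: real
    show "amalg_mult lact ract (p + p') q = amalg_mult lact ract p q + amalg_mult lact ract p' q"
      by (cases p; cases p'; cases q) (simp add: plus_amalg_def algebra_simps l.add_left r.add_left)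
    show "amalg_mult lact ract p (q + q') = amalg_mult lact ract p q + amalg_mult lact ract p q'"
      by (cases p; cases q'; cases q) (simp add: plus_amalg_def algebra_simps l.add_right r.add_right)
    show "amalg_mult lact ract (r *\<^sub>R p) q = r *\<^sub>R amalg_mult lact ract p q"
      by (cases p; cases q) (simp add: scaleR_amalg_def scaleR_add_right l.scaleR_left r.scaleR_left)
    show "amalg_mult lact ract p (r *\<^sub>R q) = r *\<^sub>R amalg_mult lact ract p q"
      by (cases p; cases q) (simp add: scaleR_amalg_def scaleR_add_right l.scaleR_right r.scaleR_right)
  qed
  moreover have "amalg_mult lact ract (c *\<^sub>C p) q = c *\<^sub>C amalg_mult lact ract p q"
    "amalg_mult lact ract p (c *\<^sub>C q) = c *\<^sub>C amalg_mult lact ract p q" for c p q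
    by (cases p; cases q; simp add: scaleC_amalg_def scaleC_add_right l_scaleC r_scaleC
        mult_scaleC_left mult_scaleC_right)+
  ultimately show ?thesis by (simp add: bounded_cbilinear_def)
qed

lemma norm_amalg_mult:
  assumes "\<And>\<beta> a. norm (lact \<beta> a) \<le> norm \<beta> * norm a" "\<And>a \<beta>. norm (ract a \<beta>) \<le> norm a * norm \<beta>"
  shows "norm (amalg_mult lact ract p q) \<le> norm p * norm q"
proof (cases p; cases q)
  fix a b \<beta> \<gamma>
  assume pq: "p = Amalg a \<beta>" "q = Amalg b \<gamma>"
  have "norm (a * b + ract a \<gamma> + lact \<beta> b) + norm (\<beta> * \<gamma>)
      \<le> norm a * norm b + norm a * norm \<gamma> + norm \<beta> * norm b + norm \<beta> * norm \<gamma>"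
    by (intro add_mono norm_triangle_le norm_mult_ineq assms)
  then show ?thesis by (simp add: pq norm_amalg_def algebra_simps)
qed


section \<open>Property H1\<close>

text \<open>The operators of the paper in terms of those above, for \<open>f\<close> in the dual of \<open>'a\<close> and \<open>g\<close> in the
  dual of \<open>'f\<close>:
  \<^item> \<open>dual_lact (*) a f\<close> has value \<open>f (b * a)\<close> at \<open>b\<close> and \<open>dual_ract (*) f a\<close> has value \<open>f (a * b)\<close>
    (open triangle and circle; likewise for \<open>g\<close> and \<open>\<beta>\<close>);
  \<^item> \<open>dual_lact ract \<beta> f\<close> has value \<open>f (ract b \<beta>)\<close> at \<open>b\<close> and \<open>dual_ract lact f \<beta>\<close> has value
    \<open>f (lact \<beta> b)\<close> (filled triangle and bullet, with values in the dual of \<open>'a\<close>);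
  \<^item> \<open>cross_lact lact a f\<close> has value \<open>f (lact \<gamma> a)\<close> at \<open>\<gamma>\<close> and \<open>cross_ract ract f a\<close> has value
    \<open>f (ract a \<gamma>)\<close> (filled triangle and bullet, with values in the dual of \<open>'f\<close>).\<close>

definition cross_lact ::
  "('f::complex_banach \<Rightarrow> 'a::complex_banach \<Rightarrow> 'a) \<Rightarrow> 'a \<Rightarrow> 'a dual \<Rightarrow> 'f dual" where
  "cross_lact lact a f = pullback (\<lambda>\<gamma>. lact \<gamma> a) f"

definition cross_ract ::
  "('a::complex_banach \<Rightarrow> 'f::complex_banach \<Rightarrow> 'a) \<Rightarrow> 'a dual \<Rightarrow> 'a \<Rightarrow> 'f dual" where
  "cross_ract ract f a = pullback (\<lambda>\<gamma>. ract a \<gamma>) f"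

definition property_H1 ::
  "('f \<Rightarrow> 'a \<Rightarrow> 'a) \<Rightarrow> ('a::complex_banach_algebra \<Rightarrow> 'f::complex_banach_algebra \<Rightarrow> 'a) \<Rightarrow> bool" where
  "property_H1 lact ract \<longleftrightarrow>
     (\<forall>D1A :: 'a \<Rightarrow> 'a dual. derivation (*) (dual_lact (*)) (dual_ract (*)) D1A \<longrightarrow>
       (\<exists>(D1F :: 'f \<Rightarrow> 'a dual) (D2A :: 'a \<Rightarrow> 'f dual).
          derivation (*) (dual_lact ract) (dual_ract lact) D1F \<and>
          bounded_clinear D2A \<and>
          (\<forall>a b \<beta>.
             D1A (lact \<beta> a) = dual_ract (*) (D1F \<beta>) a + dual_lact ract \<beta> (D1A a) \<and>
             D1A (ract a \<beta>) = dual_lact (*) a (D1F \<beta>) + dual_ract lact (D1A a) \<beta> \<and>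
             D2A (lact \<beta> a) = cross_ract ract (D1F \<beta>) a + dual_lact (*) \<beta> (D2A a) \<and>
             D2A (ract a \<beta>) = cross_lact lact a (D1F \<beta>) + dual_ract (*) (D2A a) \<beta> \<and>
             D2A (a * b) = cross_ract ract (D1A a) b + cross_lact lact a (D1A b))))"

end

theory Submission
  imports Defs
begin

text \<open>
  A derivation \<open>D\<close> of an algebra into its dual is the same thing as the bilinear form
  \<open>\<psi> s t = \<langle>D s, t\<rangle>\<close>. If \<open>D\<close> is cyclic, that is, if \<open>\<psi>\<close> is antisymmetric, the Leibniz rule becomes
  \<open>\<psi> (st) u + \<psi> (tu) s + \<psi> (us) t = 0\<close>, and \<open>D\<close> is inner exactly when
  \<open>\<psi> s t = x (ts) - x (st)\<close> for some functional \<open>x\<close>. Cyclic amenability thus says that every bounded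
  cyclic 1-cocycle is a coboundary (\<open>cyclicly_amenable_iff_cocycles\<close>).

  Coboundaries restrict to coboundaries along a homomorphism. Hence cyclic amenability passes from
  \<open>C\<close> to \<open>B\<close> whenever a homomorphism \<open>B \<rightarrow> C\<close> is such that every cyclic cocycle of \<open>B\<close> is the
  restriction of one of \<open>C\<close> (\<open>cyclicly_amenable_if_cocycles_extend\<close>). Both assertions are extension
  problems from a factor of the duplication to the whole of it.

  \<^item> A cocycle of the second factor extends by composition with the projection, which is a
    homomorphism.
  \<^item> For a cocycle \<open>\<psi>\<close> of the first factor, the property H1 supplies a derivation \<open>D1F\<close> from the second
    algebra into the dual of the first. The extension is
    \<open>\<Psi> (a, \<beta>) (b, \<gamma>) = \<psi> a b - (D1F \<gamma> a - D1F \<beta> b)\<close>. Antisymmetry of \<open>\<Psi>\<close> dictates the term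
    \<open>- D1F \<gamma> a\<close>, where H1 alone would suggest \<open>D2A a \<gamma>\<close>; the two may differ. The cyclicity of \<open>\<psi>\<close>
    makes the former choice a cocycle as well
    (\<open>cyclic_cocycle_extension\<close>).
\<close>

section \<open>Bounded bilinear forms and maps into the dual\<close>

lemma bounded_bilinear_diff:
  assumes "bounded_bilinear f" "bounded_bilinear g"
  shows "bounded_bilinear (\<lambda>x y. f x y - g x y)"
proof -
  interpret f: bounded_bilinear f by fact
  interpret g: bounded_bilinear g by fact
  obtain K where K: "\<And>x y. norm (f x y) \<le> norm x * norm y * K"
    using f.bounded by blast
  obtain L where L: "\<And>x y. norm (g x y) \<le> norm x * norm y * L"
    using g.bounded by blast
  show ?thesis
  proof
    have "norm (f x y - g x y) \<le> norm x * norm y * (K + L)" for x y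
      using norm_triangle_le_diff[OF add_mono[OF K[of x y] L[of x y]]] by (simp add: distrib_left)
    then show "\<exists>K. \<forall>x y. norm (f x y - g x y) \<le> norm x * norm y * K" by blast
  qed (simp_all add: f.add_left f.add_right f.scaleR_left f.scaleR_right
      g.add_left g.add_right g.scaleR_left g.scaleR_right scaleR_diff_right)
qed

lemma bounded_bilinear_dual_apply: "bounded_bilinear dual_apply"
proof
  show "\<exists>K. \<forall>(f :: 'a dual) x. norm (dual_apply f x) \<le> norm f * norm x * K"
    using norm_dual_apply by (intro exI[of _ 1] allI) simp
qed (simp_all add: dual_apply_add dual_apply_add_right dual_apply_scaleR
    linear_scale[OF bounded_linear.linear[OF bounded_linear_dual_apply]])

lemma dual_of_bounded_linear:
  fixes f :: "'a::complex_normed_vector \<Rightarrow> complex"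
  assumes "bounded_linear f" "\<And>c x. f (c *\<^sub>C x) = c * f x"
  shows "\<exists>g. dual_apply g = f"
proof -
  have "dual_apply (Abs_dual (Blinfun f)) = f"
    using assms by (simp add: dual_apply.rep_eq Abs_dual_inverse bounded_linear_Blinfun_apply)
  then show ?thesis ..
qed

lemma bounded_clinear_map_of_bilinear_form:
  fixes \<psi> :: "'b::complex_normed_vector \<Rightarrow> 'c::complex_normed_vector \<Rightarrow> complex"
  assumes "bounded_bilinear \<psi>"
    and left: "\<And>c s t. \<psi> (c *\<^sub>C s) t = c * \<psi> s t" and right: "\<And>c s t. \<psi> s (c *\<^sub>C t) = c * \<psi> s t"
  shows "\<exists>D. bounded_clinear D \<and> (\<forall>s. dual_apply (D s) = \<psi> s)"
proof -
  interpret bounded_bilinear \<psi> by fact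
  have "\<forall>s. \<exists>g. dual_apply g = \<psi> s"
    using dual_of_bounded_linear bounded_linear_right right by blast
  then obtain D where D: "\<And>s. dual_apply (D s) = \<psi> s" by metis
  obtain K where K: "0 \<le> K" "\<And>s t. norm (\<psi> s t) \<le> norm s * norm t * K"
    using nonneg_bounded by blast
  have "norm (D s) \<le> norm s * K" for s
    by (rule norm_dual_bound) (use K in \<open>auto simp: D mult_ac\<close>)
  then have "bounded_linear D"
    by (intro bounded_linear_intro)
      (auto intro!: dual_eqI simp: D dual_apply_add dual_apply_scaleR add_left scaleR_left)
  then have "bounded_clinear D"
    by (auto simp: bounded_clinear_def D dual_apply_scaleC left intro!: dual_eqI)
  then show ?thesis using D by blast
qed


section \<open>Cyclic cocycles\<close>

text \<open>The bounded cyclic 1-cocycles of Connes' cyclic cohomology. Complex homogeneity in the second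
  argument follows from antisymmetry.\<close>

definition cyclic_cocycle ::
  "('c::complex_banach \<Rightarrow> 'c \<Rightarrow> 'c) \<Rightarrow> ('c \<Rightarrow> 'c \<Rightarrow> complex) \<Rightarrow> bool" where
  "cyclic_cocycle m \<psi> \<longleftrightarrow> bounded_bilinear \<psi> \<and> (\<forall>c s t. \<psi> (c *\<^sub>C s) t = c * \<psi> s t) \<and>
     (\<forall>s t. \<psi> s t + \<psi> t s = 0) \<and> (\<forall>s t u. \<psi> (m s t) u + \<psi> (m t u) s + \<psi> (m u s) t = 0)"

text \<open>The Leibniz rule at \<open>u\<close> reads \<open>\<psi> (st) u = \<psi> s (tu) + \<psi> t (us)\<close>. Antisymmetry moves both terms
  of the right-hand side into the cyclic sum, and the step can be reversed.\<close>

lemma cyclic_cocycle_of_derivation: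
  assumes "bounded_cbilinear m" "derivation m (dual_lact m) (dual_ract m) D" "cyclic D"
  shows "cyclic_cocycle m (\<lambda>s. dual_apply (D s))"
proof -
  have D: "bounded_linear D" "\<And>c s. D (c *\<^sub>C s) = c *\<^sub>C D s"
    and leibniz: "D (m s t) = dual_ract m (D s) t + dual_lact m s (D t)" for s t
    using assms(2) by (auto simp: derivation_def bounded_clinear_def)
  have anti: "dual_apply (D s) t + dual_apply (D t) s = 0" for s t
    using assms(3) by (simp add: cyclic_def)
  have "dual_apply (D (m s t)) u + dual_apply (D (m t u)) s + dual_apply (D (m u s)) t = 0" for s t u
    using anti[of "m t u" s] anti[of "m u s" t]
    by (simp add: leibniz dual_apply_add dual_apply_dual_lact[OF assms(1)]
        dual_apply_dual_ract[OF assms(1)] add_eq_0_iff)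
  then show ?thesis
    using bounded_bilinear.comp1[OF bounded_bilinear_dual_apply D(1)] anti
    by (simp add: cyclic_cocycle_def D(2) dual_apply_scaleC)
qed

lemma derivation_of_cyclic_cocycle:
  assumes "bounded_cbilinear m" "cyclic_cocycle m \<psi>"
  shows "\<exists>D. derivation m (dual_lact m) (dual_ract m) D \<and> cyclic D \<and> (\<forall>s. dual_apply (D s) = \<psi> s)"
proof -
  have anti: "\<psi> s t + \<psi> t s = 0" and left: "\<psi> (c *\<^sub>C s) t = c * \<psi> s t"
    and cocycle: "\<psi> (m s t) u + \<psi> (m t u) s + \<psi> (m u s) t = 0" for c s t u
    using assms(2) unfolding cyclic_cocycle_def by blast+
  have "\<psi> s (c *\<^sub>C t) = c * \<psi> s t" for c s t
    by (metis anti left mult_minus_right add_eq_0_iff)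
  then obtain D where D: "bounded_clinear D" "\<And>s. dual_apply (D s) = \<psi> s"
    using bounded_clinear_map_of_bilinear_form[of \<psi>] assms(2) left unfolding cyclic_cocycle_def by blast
  have "D (m s t) = dual_ract m (D s) t + dual_lact m s (D t)" for s t
  proof (rule dual_eqI)
    show "dual_apply (D (m s t)) u = dual_apply (dual_ract m (D s) t + dual_lact m s (D t)) u" for u
      using cocycle[of s t u] anti[of "m t u" s] anti[of "m u s" t]
      by (simp add: D dual_apply_add dual_apply_dual_lact[OF assms(1)]
          dual_apply_dual_ract[OF assms(1)] add_eq_0_iff)
  qed
  then have "derivation m (dual_lact m) (dual_ract m) D"
    using D(1) by (simp add: derivation_def)
  moreover have "cyclic D"
    using anti by (simp add: cyclic_def D)
  ultimately show ?thesis using D(2) by blast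
qed

definition cyclic_coboundary ::
  "('c::complex_banach \<Rightarrow> 'c \<Rightarrow> 'c) \<Rightarrow> ('c \<Rightarrow> 'c \<Rightarrow> complex) \<Rightarrow> bool" where
  "cyclic_coboundary m \<psi> \<longleftrightarrow> (\<exists>x. \<forall>s t. \<psi> s t = dual_apply x (m t s) - dual_apply x (m s t))"

lemma inner_derivation_iff_coboundary:
  assumes "bounded_cbilinear m"
  shows "inner_derivation (dual_lact m) (dual_ract m) D \<longleftrightarrow> cyclic_coboundary m (\<lambda>s. dual_apply (D s))"
proof -
  have "D s = dual_lact m s x - dual_ract m x s
      \<longleftrightarrow> (\<forall>t. dual_apply (D s) t = dual_apply x (m t s) - dual_apply x (m s t))" for s x
    using assms
    by (auto simp: dual_apply_diff dual_apply_dual_lact dual_apply_dual_ract intro!: dual_eqI)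
  then show ?thesis
    by (simp add: inner_derivation_def cyclic_coboundary_def)
qed

lemma cyclicly_amenable_iff_cocycles:
  assumes "bounded_cbilinear m"
  shows "cyclicly_amenable m \<longleftrightarrow> (\<forall>\<psi>. cyclic_cocycle m \<psi> \<longrightarrow> cyclic_coboundary m \<psi>)"
proof
  assume am: "cyclicly_amenable m"
  show "\<forall>\<psi>. cyclic_cocycle m \<psi> \<longrightarrow> cyclic_coboundary m \<psi>"
  proof (intro allI impI)
    fix \<psi> assume "cyclic_cocycle m \<psi>"
    then obtain D where D: "derivation m (dual_lact m) (dual_ract m) D" "cyclic D"
      and ap: "\<And>s. dual_apply (D s) = \<psi> s"
      using derivation_of_cyclic_cocycle[OF assms] by blast
    then have "inner_derivation (dual_lact m) (dual_ract m) D"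
      using am by (simp add: cyclicly_amenable_def)
    then show "cyclic_coboundary m \<psi>"
      by (simp add: inner_derivation_iff_coboundary[OF assms] ap)
  qed
next
  assume "\<forall>\<psi>. cyclic_cocycle m \<psi> \<longrightarrow> cyclic_coboundary m \<psi>"
  then show "cyclicly_amenable m"
    using cyclic_cocycle_of_derivation[OF assms]
    by (simp add: cyclicly_amenable_def inner_derivation_iff_coboundary[OF assms])
qed

text \<open>If \<open>x\<close> witnesses that the extension is a coboundary, then \<open>x \<circ> \<iota>\<close> witnesses it for the
  restriction, because \<open>\<iota>\<close> is multiplicative.\<close>

lemma cyclicly_amenable_if_cocycles_extend:
  fixes m :: "'b::complex_banach \<Rightarrow> 'b \<Rightarrow> 'b" and n :: "'c::complex_banach \<Rightarrow> 'c \<Rightarrow> 'c"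
  assumes "bounded_cbilinear m" "bounded_cbilinear n"
    and \<iota>: "bounded_clinear \<iota>" "\<And>s t. \<iota> (m s t) = n (\<iota> s) (\<iota> t)"
    and "cyclicly_amenable n"
    and ext: "\<And>\<psi>. cyclic_cocycle m \<psi> \<Longrightarrow> \<exists>\<Psi>. cyclic_cocycle n \<Psi> \<and> (\<forall>s t. \<Psi> (\<iota> s) (\<iota> t) = \<psi> s t)"
  shows "cyclicly_amenable m"
  unfolding cyclicly_amenable_iff_cocycles[OF assms(1)]
proof (intro allI impI)
  fix \<psi> assume "cyclic_cocycle m \<psi>"
  then obtain \<Psi> where \<Psi>: "cyclic_cocycle n \<Psi>" "\<And>s t. \<Psi> (\<iota> s) (\<iota> t) = \<psi> s t"
    using ext by blast
  then have "cyclic_coboundary n \<Psi>"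
    using assms(5) by (simp add: cyclicly_amenable_iff_cocycles[OF assms(2)])
  then obtain x where "\<And>s t. \<Psi> s t = dual_apply x (n t s) - dual_apply x (n s t)"
    by (auto simp: cyclic_coboundary_def)
  then have "\<psi> s t = dual_apply (pullback \<iota> x) (m t s) - dual_apply (pullback \<iota> x) (m s t)" for s t
    by (simp add: dual_apply_pullback \<iota> flip: \<Psi>(2))
  then show "cyclic_coboundary m \<psi>"
    by (auto simp: cyclic_coboundary_def)
qed

lemma cyclic_cocycle_compose:
  assumes "cyclic_cocycle m \<psi>" "bounded_clinear \<theta>" "\<And>p q. \<theta> (n p q) = m (\<theta> p) (\<theta> q)"
  shows "cyclic_cocycle n (\<lambda>p q. \<psi> (\<theta> p) (\<theta> q))"
proof -
  have "bounded_bilinear (\<lambda>p q. \<psi> (\<theta> p) (\<theta> q))"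
    using assms(1,2) bounded_bilinear.comp
    unfolding cyclic_cocycle_def bounded_clinear_def by blast
  then show ?thesis
    using assms unfolding cyclic_cocycle_def bounded_clinear_def by simp
qed


section \<open>The amalgamated duplication\<close>

lemma bounded_clinear_fst_amalg: "bounded_clinear fst_amalg"
  and bounded_clinear_snd_amalg: "bounded_clinear snd_amalg"
  unfolding bounded_clinear_def
  by (auto intro!: bounded_linear_intro[where K = 1]
      simp: plus_amalg_def scaleR_amalg_def scaleC_amalg_def norm_amalg_def)

lemma scaleC_zero: "c *\<^sub>C (0 :: 'a::complex_normed_vector) = 0"
  by (metis mult_zero_right norm_eq_zero norm_scaleC)

lemma bounded_clinear_Amalg_left: "bounded_clinear (\<lambda>a. Amalg a 0)"
  and bounded_clinear_Amalg_right: "bounded_clinear (Amalg 0)"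
  unfolding bounded_clinear_def
  by (auto intro!: bounded_linear_intro[where K = 1]
      simp: plus_amalg_def scaleR_amalg_def scaleC_amalg_def norm_amalg_def scaleC_zero)

lemma snd_amalg_mult: "snd_amalg (amalg_mult lact ract p q) = snd_amalg p * snd_amalg q"
  by (cases p; cases q) simp

text \<open>The cocycle sum of the extension splits according to how many of the three arguments come from
  the second algebra: with none it is the sum for \<open>\<psi>\<close>, with one it vanishes by the hypothesis
  linking \<open>\<psi>\<close> and \<open>D\<close> together with antisymmetry of \<open>\<psi>\<close>, with two by the Leibniz rule for \<open>D\<close>. The
  contribution of three is zero, since the extension vanishes when both of its arguments come from
  the second algebra.\<close>

lemma cyclic_cocycle_extension:
  fixes lact :: "'f::complex_banach_algebra \<Rightarrow> 'a::complex_banach_algebra \<Rightarrow> 'a"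
  assumes "banach_bimodule (*) lact ract"
    and \<psi>: "cyclic_cocycle (*) \<psi>"
    and D: "derivation (*) (dual_lact ract) (dual_ract lact) D"
    and link: "\<And>a b \<gamma>. \<psi> (ract b \<gamma>) a = dual_apply (D \<gamma>) (a * b) + \<psi> b (lact \<gamma> a)"
  shows "cyclic_cocycle (amalg_mult lact ract)
    (\<lambda>p q. \<psi> (fst_amalg p) (fst_amalg q)
      - (dual_apply (D (snd_amalg q)) (fst_amalg p) - dual_apply (D (snd_amalg p)) (fst_amalg q)))"
    (is "cyclic_cocycle ?n ?\<Psi>")
proof -
  interpret banach_bimodule "(*)" lact ract by fact
  have anti: "\<psi> s t + \<psi> t s = 0" and scaleC: "\<psi> (c *\<^sub>C s) t = c * \<psi> s t"
    and cocycle: "\<psi> (s * t) u + \<psi> (t * u) s + \<psi> (u * s) t = 0" for c s t u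
    using \<psi> unfolding cyclic_cocycle_def by blast+
  have bil: "bounded_bilinear \<psi>"
    using \<psi> by (simp add: cyclic_cocycle_def)
  interpret bounded_bilinear \<psi> by (rule bil)
  have D_lin: "bounded_linear D" "\<And>c \<beta>. D (c *\<^sub>C \<beta>) = c *\<^sub>C D \<beta>"
    and "\<And>\<beta> \<gamma>. D (\<beta> * \<gamma>) = dual_ract lact (D \<beta>) \<gamma> + dual_lact ract \<beta> (D \<gamma>)"
    using D by (auto simp: derivation_def bounded_clinear_def)
  then have leibniz: "dual_apply (D (\<beta> * \<gamma>)) a
      = dual_apply (D \<beta>) (lact \<gamma> a) + dual_apply (D \<gamma>) (ract a \<beta>)" for \<beta> \<gamma> a
    by (simp add: dual_apply_add dual_apply_dual_lact[OF bounded_ract]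
        dual_apply_dual_ract[OF bounded_lact])
  have fst_lin: "bounded_linear (fst_amalg :: ('a, 'f) amalg \<Rightarrow> 'a)"
    and snd_lin: "bounded_linear (snd_amalg :: ('a, 'f) amalg \<Rightarrow> 'f)"
    using bounded_clinear_fst_amalg bounded_clinear_snd_amalg by (auto simp: bounded_clinear_def)
  have mixed: "bounded_bilinear
      (\<lambda>(p :: ('a, 'f) amalg) (q :: ('a, 'f) amalg). dual_apply (D (snd_amalg p)) (fst_amalg q))"
    by (rule bounded_bilinear.comp[OF bounded_bilinear_dual_apply
          bounded_linear_compose[OF D_lin(1) snd_lin] fst_lin])
  have "bounded_bilinear ?\<Psi>"
    by (intro bounded_bilinear_diff mixed bounded_bilinear.flip[OF mixed]
        bounded_bilinear.comp[OF bil fst_lin fst_lin])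
  moreover have "?\<Psi> (c *\<^sub>C p) q = c * ?\<Psi> p q" for c p q
    by (simp add: scaleC_amalg_def scaleC D_lin(2) dual_apply_scaleC dual_apply_scaleC_right
        algebra_simps)
  moreover have "?\<Psi> p q + ?\<Psi> q p = 0" for p q
    using anti[of "fst_amalg p" "fst_amalg q"] by (simp add: algebra_simps)
  moreover have "?\<Psi> (?n p q) r + ?\<Psi> (?n q r) p + ?\<Psi> (?n r p) q = 0" for p q r
  proof (cases p; cases q; cases r)
    fix a \<alpha> b \<beta> c \<gamma>
    assume [simp]: "p = Amalg a \<alpha>" "q = Amalg b \<beta>" "r = Amalg c \<gamma>"
    have one: "\<psi> (ract t \<delta>) s + \<psi> (lact \<delta> s) t - dual_apply (D \<delta>) (s * t) = 0" for s t \<delta>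
      using anti[of "lact \<delta> s" t] by (simp add: link add.commute)
    have two: "dual_apply (D (\<delta> * \<epsilon>)) s - dual_apply (D \<delta>) (lact \<epsilon> s)
        - dual_apply (D \<epsilon>) (ract s \<delta>) = 0" for \<delta> \<epsilon> s
      by (simp add: leibniz)
    show ?thesis
      using cocycle[of a b c] one[of b \<gamma> a] one[of c \<alpha> b] one[of a \<beta> c]
        two[of \<alpha> \<beta> c] two[of \<beta> \<gamma> a] two[of \<gamma> \<alpha> b]
      by (simp add: add_left dual_apply_add_right) algebra
  qed
  ultimately show ?thesis
    unfolding cyclic_cocycle_def by blast
qed

lemma cyclicly_amenable_second_factor:
  fixes lact :: "'f::complex_banach_algebra \<Rightarrow> 'a::complex_banach_algebra \<Rightarrow> 'a"
  assumes "banach_bimodule (*) lact ract" "cyclicly_amenable (amalg_mult lact ract)"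
  shows "cyclicly_amenable ((*) :: 'f \<Rightarrow> 'f \<Rightarrow> 'f)"
proof (rule cyclicly_amenable_if_cocycles_extend[where \<iota> = "Amalg 0"])
  interpret banach_bimodule "(*)" lact ract by fact
  interpret l: bounded_bilinear lact using bounded_lact by (simp add: bounded_cbilinear_def)
  interpret r: bounded_bilinear ract using bounded_ract by (simp add: bounded_cbilinear_def)
  show "Amalg 0 (s * t) = amalg_mult lact ract (Amalg 0 s) (Amalg 0 t)" for s t
    by (simp add: l.zero_right r.zero_left)
  fix \<psi> :: "'f \<Rightarrow> 'f \<Rightarrow> complex"
  assume "cyclic_cocycle (*) \<psi>"
  then have "cyclic_cocycle (amalg_mult lact ract) (\<lambda>p q. \<psi> (snd_amalg p) (snd_amalg q))"
    by (rule cyclic_cocycle_compose[where m = "(*)" and \<theta> = snd_amalg])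
      (simp_all add: bounded_clinear_snd_amalg snd_amalg_mult)
  then show "\<exists>\<Psi>. cyclic_cocycle (amalg_mult lact ract) \<Psi>
      \<and> (\<forall>s t. \<Psi> (Amalg 0 s) (Amalg 0 t) = \<psi> s t)"
    by (intro exI[of _ "\<lambda>p q. \<psi> (snd_amalg p) (snd_amalg q)"]) simp
qed (use assms in \<open>auto intro: bounded_cbilinear_times bounded_cbilinear_amalg_mult
      bounded_clinear_Amalg_right\<close>)

lemma cyclicly_amenable_first_factor:
  fixes lact :: "'f::complex_banach_algebra \<Rightarrow> 'a::complex_banach_algebra \<Rightarrow> 'a"
  assumes "banach_bimodule (*) lact ract" "cyclicly_amenable (amalg_mult lact ract)"
    and H1: "property_H1 lact ract"
  shows "cyclicly_amenable ((*) :: 'a \<Rightarrow> 'a \<Rightarrow> 'a)"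
proof (rule cyclicly_amenable_if_cocycles_extend[where \<iota> = "\<lambda>a. Amalg a 0"])
  interpret banach_bimodule "(*)" lact ract by fact
  interpret l: bounded_bilinear lact using bounded_lact by (simp add: bounded_cbilinear_def)
  interpret r: bounded_bilinear ract using bounded_ract by (simp add: bounded_cbilinear_def)
  show "Amalg (s * t) 0 = amalg_mult lact ract (Amalg s 0) (Amalg t 0)" for s t
    by (simp add: l.zero_left r.zero_right)
  fix \<psi> :: "'a \<Rightarrow> 'a \<Rightarrow> complex"
  assume \<psi>: "cyclic_cocycle (*) \<psi>"
  then obtain D1A :: "'a \<Rightarrow> 'a dual" where
    D1A: "derivation (*) (dual_lact (*)) (dual_ract (*)) D1A" "\<And>s. dual_apply (D1A s) = \<psi> s"
    using derivation_of_cyclic_cocycle[OF bounded_cbilinear_times] by blast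
  obtain D1F :: "'f \<Rightarrow> 'a dual" where
    D1F: "derivation (*) (dual_lact ract) (dual_ract lact) D1F"
    and link: "\<And>b \<gamma>. D1A (ract b \<gamma>) = dual_lact (*) b (D1F \<gamma>) + dual_ract lact (D1A b) \<gamma>"
    using H1 D1A(1) unfolding property_H1_def by blast
  have "\<psi> (ract b \<gamma>) a = dual_apply (D1F \<gamma>) (a * b) + \<psi> b (lact \<gamma> a)" for a b \<gamma>
    using arg_cong[OF link, of "\<lambda>f. dual_apply f a" b \<gamma>]
    by (simp add: D1A(2) dual_apply_add dual_apply_dual_lact[OF bounded_cbilinear_times]
        dual_apply_dual_ract[OF bounded_lact])
  then have "cyclic_cocycle (amalg_mult lact ract)
    (\<lambda>p q. \<psi> (fst_amalg p) (fst_amalg q)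
      - (dual_apply (D1F (snd_amalg q)) (fst_amalg p) - dual_apply (D1F (snd_amalg p)) (fst_amalg q)))"
    (is "cyclic_cocycle _ ?\<Psi>")
    by (rule cyclic_cocycle_extension[OF assms(1) \<psi> D1F])
  moreover have "D1F 0 = 0"
    using D1F bounded_linear.linear linear_0 by (auto simp: derivation_def bounded_clinear_def)
  ultimately show "\<exists>\<Psi>. cyclic_cocycle (amalg_mult lact ract) \<Psi>
      \<and> (\<forall>s t. \<Psi> (Amalg s 0) (Amalg t 0) = \<psi> s t)"
    by (intro exI[of _ ?\<Psi>]) (simp add: dual_apply_zero)
qed (use assms in \<open>auto intro: bounded_cbilinear_times bounded_cbilinear_amalg_mult
      bounded_clinear_Amalg_left\<close>)

theorem theorem5p7:
  fixes lact :: "'f::complex_banach_algebra \<Rightarrow> 'a::complex_banach_algebra \<Rightarrow> 'a"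
    and ract :: "'a \<Rightarrow> 'f \<Rightarrow> 'a"
  assumes "banach_bimodule (*) lact ract"
    and "compatible_actions lact ract"
    and "cyclicly_amenable (amalg_mult lact ract)"
  shows "cyclicly_amenable ((*) :: 'f \<Rightarrow> 'f \<Rightarrow> 'f) \<and>
    (property_H1 lact ract \<longrightarrow> cyclicly_amenable ((*) :: 'a \<Rightarrow> 'a \<Rightarrow> 'a))"
  using assms(1,3) cyclicly_amenable_second_factor cyclicly_amenable_first_factor by blast

end
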